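(* Let $\Omega$ be an SMT formula over an ordered finite set of theory variables $Y_1, Y_2, \ldots, Y_m$, and let $\theta$ be a symmetry of $\Omega$. Define the symmetry breaking predicate $$SBP(\theta) \;=\; \bigwedge_{1 \le i \le m} \Big( \big(\textstyle\bigwedge_{1 \le j < i} Y_j = \theta(Y_j)\big) \Rightarrow \big(Y_i \preceq \theta(Y_i)\big)\Big),$$ where $Y_j = \theta(Y_j)$ means the two variables take equal values and $Y_i \preceq \theta(Y_i)$ means that the value of $Y_i$ is less than or equal to the value of $\theta(Y_i)$ in the total order of their common domain. Let $\Omega' = \Omega \wedge SBP(\theta)$. Then $\Omega$ is satisfiable if and only if $\Omega'$ is satisfiable.
   Context: An SMT formula is built from operations (e.g. arithmetic, comparison, equality) over typed theory variables (integers, reals, Booleans, etc.) combined with Boolean connectives; it is satisfiable if some assignment of values from their domains to the variables makes it true. Each variable type $t$ has a domain $D_t$ (finite or countably infinite) equipped with a fixed total order (the natural order for integers; an arbitrary fixed order for finite domains). The variables are listed in a fixed order $Y_1,\dots,Y_m$, in which all variables of a given type precede those of any later type in a fixed ordering of the types. A symmetry of $\Omega$ is a permutation $\theta$ of the variables $\{Y_1,\dots,Y_m\}$ mapping each variable to a variable of the same type (same domain) such that simultaneously replacing every variable $Y$ in $\Omega$ by $\theta(Y)$ yields $\Omega$ again (the same set of constraints). *)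

theory Defs
  imports
    "HOL-Library.Multiset"
    "HOL-Library.FSet"
    "HOL-Library.Uprod"
    "HOL-Library.Countable_Set"
    "HOL-Combinatorics.Permutations"
begin

text \<open>
  A many-sorted SMT language with a fixed interpretation of its operations.  Syntactic identity is
  meant to be insensitive to argument order wherever that order is irrelevant: conjunctions and
  disjunctions range over finite sets of formulas, an equation holds an unordered pair of terms, and
  besides ordinary operations (symbols \<open>'f\<close>, a list of arguments) there are commutative ones
  (symbols \<open>'c\<close>, a multiset of arguments), such as addition.
\<close>

datatype (dead 'f, dead 'c, term_vars: 'v) smt_term =
    Var 'v
  | Op 'f "('f, 'c, 'v) smt_term list"
  | COp 'c "('f, 'c, 'v) smt_term multiset"
  for map: rename_term

text \<open>
  \<open>Atom t\<close> is a Boolean-typed term used as a formula: a Boolean variable or the result of a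
  predicate. \<open>Leq \<tau> s t\<close> compares two terms of type \<open>\<tau>\<close> in the order of the domain of \<open>\<tau>\<close>.
\<close>

datatype (dead 'ty, dead 'f, dead 'c, vars: 'v) smt_formula =
    Atom "('f, 'c, 'v) smt_term"
  | Eq "('f, 'c, 'v) smt_term uprod"
  | Leq 'ty "('f, 'c, 'v) smt_term" "('f, 'c, 'v) smt_term"
  | Neg "('ty, 'f, 'c, 'v) smt_formula"
  | Conj "('ty, 'f, 'c, 'v) smt_formula fset"
  | Disj "('ty, 'f, 'c, 'v) smt_formula fset"
  | Imp "('ty, 'f, 'c, 'v) smt_formula" "('ty, 'f, 'c, 'v) smt_formula"
  for map: rename

text \<open>The domains of all types are subsets of one universe \<open>'d\<close> of values.\<close>

record ('ty, 'f, 'c, 'd) smt_theory =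
  dom :: "'ty \<Rightarrow> 'd set"
  ord :: "'ty \<Rightarrow> 'd rel"
  bool_ty :: 'ty
  true_val :: 'd
  false_val :: 'd
  op_args :: "'f \<Rightarrow> 'ty list"
  op_res :: "'f \<Rightarrow> 'ty"
  op_fun :: "'f \<Rightarrow> 'd list \<Rightarrow> 'd"
  cop_arity :: "'c \<Rightarrow> nat"
  cop_arg :: "'c \<Rightarrow> 'ty"
  cop_res :: "'c \<Rightarrow> 'ty"
  cop_fun :: "'c \<Rightarrow> 'd multiset \<Rightarrow> 'd"

definition smt_theory :: "('ty, 'f, 'c, 'd) smt_theory \<Rightarrow> bool" where
  "smt_theory T \<longleftrightarrow>
     (\<forall>\<tau>. countable (dom T \<tau>)) \<and>
     (\<forall>\<tau>. linear_order_on (dom T \<tau>) (ord T \<tau>)) \<and>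
     dom T (bool_ty T) = {true_val T, false_val T} \<and> true_val T \<noteq> false_val T \<and>
     (\<forall>f ds. list_all2 (\<lambda>d \<tau>. d \<in> dom T \<tau>) ds (op_args T f)
        \<longrightarrow> op_fun T f ds \<in> dom T (op_res T f)) \<and>
     (\<forall>c D. size D = cop_arity T c \<and> set_mset D \<subseteq> dom T (cop_arg T c)
        \<longrightarrow> cop_fun T c D \<in> dom T (cop_res T c))"

inductive has_type ::
  "('ty, 'f, 'c, 'd) smt_theory \<Rightarrow> ('v \<Rightarrow> 'ty) \<Rightarrow> ('f, 'c, 'v) smt_term \<Rightarrow> 'ty \<Rightarrow> bool"
  for T :: "('ty, 'f, 'c, 'd) smt_theory" and ty :: "'v \<Rightarrow> 'ty" where
  "has_type T ty (Var v) (ty v)"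
| "list_all2 (has_type T ty) ts (op_args T f) \<Longrightarrow> has_type T ty (Op f ts) (op_res T f)"
| "size M = cop_arity T c \<Longrightarrow> \<forall>t\<in>set_mset M. has_type T ty t (cop_arg T c)
     \<Longrightarrow> has_type T ty (COp c M) (cop_res T c)"

inductive well_typed ::
  "('ty, 'f, 'c, 'd) smt_theory \<Rightarrow> ('v \<Rightarrow> 'ty) \<Rightarrow> ('ty, 'f, 'c, 'v) smt_formula \<Rightarrow> bool"
  for T :: "('ty, 'f, 'c, 'd) smt_theory" and ty :: "'v \<Rightarrow> 'ty" where
  "has_type T ty t (bool_ty T) \<Longrightarrow> well_typed T ty (Atom t)"
| "has_type T ty s \<tau> \<Longrightarrow> has_type T ty t \<tau> \<Longrightarrow> well_typed T ty (Eq (Upair s t))"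
| "has_type T ty s \<tau> \<Longrightarrow> has_type T ty t \<tau> \<Longrightarrow> well_typed T ty (Leq \<tau> s t)"
| "well_typed T ty \<phi> \<Longrightarrow> well_typed T ty (Neg \<phi>)"
| "\<forall>\<phi>\<in>fset \<Phi>. well_typed T ty \<phi> \<Longrightarrow> well_typed T ty (Conj \<Phi>)"
| "\<forall>\<phi>\<in>fset \<Phi>. well_typed T ty \<phi> \<Longrightarrow> well_typed T ty (Disj \<Phi>)"
| "well_typed T ty \<phi> \<Longrightarrow> well_typed T ty \<psi> \<Longrightarrow> well_typed T ty (Imp \<phi> \<psi>)"

primrec eval :: "('ty, 'f, 'c, 'd) smt_theory \<Rightarrow> ('v \<Rightarrow> 'd) \<Rightarrow> ('f, 'c, 'v) smt_term \<Rightarrow> 'd" where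
  "eval T \<alpha> (Var v) = \<alpha> v"
| "eval T \<alpha> (Op f ts) = op_fun T f (map (eval T \<alpha>) ts)"
| "eval T \<alpha> (COp c M) = cop_fun T c (image_mset (eval T \<alpha>) M)"

primrec holds ::
  "('ty, 'f, 'c, 'd) smt_theory \<Rightarrow> ('v \<Rightarrow> 'd) \<Rightarrow> ('ty, 'f, 'c, 'v) smt_formula \<Rightarrow> bool" where
  "holds T \<alpha> (Atom t) \<longleftrightarrow> eval T \<alpha> t = true_val T"
| "holds T \<alpha> (Eq p) \<longleftrightarrow> (\<forall>s\<in>set_uprod p. \<forall>t\<in>set_uprod p. eval T \<alpha> s = eval T \<alpha> t)"
| "holds T \<alpha> (Leq \<tau> s t) \<longleftrightarrow> (eval T \<alpha> s, eval T \<alpha> t) \<in> ord T \<tau>"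
| "holds T \<alpha> (Neg \<phi>) \<longleftrightarrow> \<not> holds T \<alpha> \<phi>"
| "holds T \<alpha> (Conj \<Phi>) \<longleftrightarrow> (\<forall>b\<in>fset (holds T \<alpha> |`| \<Phi>). b)"
| "holds T \<alpha> (Disj \<Phi>) \<longleftrightarrow> (\<exists>b\<in>fset (holds T \<alpha> |`| \<Phi>). b)"
| "holds T \<alpha> (Imp \<phi> \<psi>) \<longleftrightarrow> (holds T \<alpha> \<phi> \<longrightarrow> holds T \<alpha> \<psi>)"

text \<open>
  \<open>V\<close> is the set of all declared variables, whether or not they occur in \<open>\<phi>\<close>; values outside \<open>V\<close>
  are irrelevant for formulas over \<open>V\<close>.
\<close>

definition satisfiable ::
  "('ty, 'f, 'c, 'd) smt_theory \<Rightarrow> ('v \<Rightarrow> 'ty) \<Rightarrow> 'v set \<Rightarrow> ('ty, 'f, 'c, 'v) smt_formula \<Rightarrow> bool"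
  where
  "satisfiable T ty V \<phi> \<longleftrightarrow> (\<exists>\<alpha>. (\<forall>v\<in>V. \<alpha> v \<in> dom T (ty v)) \<and> holds T \<alpha> \<phi>)"

definition symmetry ::
  "('v \<Rightarrow> 'ty) \<Rightarrow> 'v set \<Rightarrow> ('ty, 'f, 'c, 'v) smt_formula \<Rightarrow> ('v \<Rightarrow> 'v) \<Rightarrow> bool" where
  "symmetry ty V \<Omega> \<theta> \<longleftrightarrow>
     \<theta> permutes V \<and> (\<forall>v\<in>V. ty (\<theta> v) = ty v) \<and> rename \<theta> \<Omega> = \<Omega>"

definition SBP ::
  "('v \<Rightarrow> 'ty) \<Rightarrow> (nat \<Rightarrow> 'v) \<Rightarrow> nat \<Rightarrow> ('v \<Rightarrow> 'v) \<Rightarrow> ('ty, 'f, 'c, 'v) smt_formula" where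
  "SBP ty Y m \<theta> =
     Conj ((\<lambda>i. Imp (Conj ((\<lambda>j. Eq (Upair (Var (Y j)) (Var (\<theta> (Y j))))) |`| fset_of_list [1..<i]))
                     (Leq (ty (Y i)) (Var (Y i)) (Var (\<theta> (Y i)))))
           |`| fset_of_list [1..<Suc m])"

end

(* Composing a model of \<Omega> with a symmetry gives another model of \<Omega>. Among the finitely many
   models of \<Omega> obtained from a given one by permuting the variables, take a lexicographically
   least one \<beta>. If \<beta> violated SBP(\<theta>) at some index i, then \<beta> \<circ> \<theta> would agree with \<beta> before i and
   be strictly smaller at i, contradicting minimality. *)
theory Submission
  imports Defs
begin

lemma eval_rename_term: "eval T \<alpha> (rename_term \<theta> t) = eval T (\<alpha> \<circ> \<theta>) t"
proof (induction t)
  case (Op f ts)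
  then show ?case by (simp add: comp_def cong: map_cong)
next
  case (COp c M)
  then show ?case by (simp add: multiset.map_comp comp_def cong: image_mset_cong)
qed simp

text \<open>When \<open>rename \<theta> \<Omega> = \<Omega>\<close>, the formula on both sides is
  \<open>\<Omega>\<close> itself, so composing an assignment with \<open>\<theta>\<close> preserves
  its truth.\<close>

lemma holds_rename: "holds T \<alpha> (rename \<theta> \<phi>) \<longleftrightarrow> holds T (\<alpha> \<circ> \<theta>) \<phi>"
  by (induction \<phi>) (auto simp: eval_rename_term[unfolded comp_def] comp_def uprod.set_map)

lemma holds_SBP:
  fixes \<alpha> :: "'v \<Rightarrow> 'd"
  shows
  "holds T \<alpha> (SBP ty Y m \<theta>) \<longleftrightarrow>
     (\<forall>i\<in>{1..m}. (\<forall>j\<in>{1..<i}. \<alpha> (Y j) = \<alpha> (\<theta> (Y j)))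
        \<longrightarrow> (\<alpha> (Y i), \<alpha> (\<theta> (Y i))) \<in> ord T (ty (Y i)))"
proof -
  \<comment> \<open>The semantics of \<open>Eq\<close> compares the members of an unordered pair in
    both directions, which leaves each equation beside its mirror image.\<close>
  have sym: "a = b \<and> b = a \<longleftrightarrow> a = b" for a b :: 'd
    by blast
  show ?thesis
    by (simp add: SBP_def fset_of_list.rep_eq atLeastLessThanSuc_atLeastAtMost sym del: upt_Suc)
qed

text \<open>The strict lexicographic order on the value tuples at \<open>Y 1\<close>, ...,
  \<open>Y m\<close>. Each \<open>ord T \<tau>\<close> is meant to be reflexive, so strictness at
  the deciding index is a separate inequality.\<close>

definition lex_less ::
  "('ty, 'f, 'c, 'd) smt_theory \<Rightarrow> ('v \<Rightarrow> 'ty) \<Rightarrow> (nat \<Rightarrow> 'v) \<Rightarrow> nat \<Rightarrow> ('v \<Rightarrow> 'd) \<Rightarrow> ('v \<Rightarrow> 'd) \<Rightarrow> bool"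
  where
  "lex_less T ty Y m \<beta> \<gamma> \<longleftrightarrow>
     (\<exists>i\<in>{1..m}. (\<forall>j\<in>{1..<i}. \<beta> (Y j) = \<gamma> (Y j)) \<and> \<beta> (Y i) \<noteq> \<gamma> (Y i) \<and>
        (\<beta> (Y i), \<gamma> (Y i)) \<in> ord T (ty (Y i)))"

lemma lex_less_irrefl: "\<not> lex_less T ty Y m \<beta> \<beta>"
  by (simp add: lex_less_def)

text \<open>The smaller of the two deciding indices decides between \<open>\<beta>\<close> and
  \<open>\<delta>\<close>: before it all three assignments agree.\<close>

lemma lex_less_trans:
  assumes ord: "\<And>\<tau>. trans (ord T \<tau>)" "\<And>\<tau>. antisym (ord T \<tau>)"
    and "lex_less T ty Y m \<beta> \<gamma>" and "lex_less T ty Y m \<gamma> \<delta>"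
  shows "lex_less T ty Y m \<beta> \<delta>"
proof -
  obtain i where i: "i \<in> {1..m}" "\<forall>j\<in>{1..<i}. \<beta> (Y j) = \<gamma> (Y j)" "\<beta> (Y i) \<noteq> \<gamma> (Y i)"
      "(\<beta> (Y i), \<gamma> (Y i)) \<in> ord T (ty (Y i))"
    using assms(3) unfolding lex_less_def by blast
  obtain k where k: "k \<in> {1..m}" "\<forall>j\<in>{1..<k}. \<gamma> (Y j) = \<delta> (Y j)" "\<gamma> (Y k) \<noteq> \<delta> (Y k)"
      "(\<gamma> (Y k), \<delta> (Y k)) \<in> ord T (ty (Y k))"
    using assms(4) unfolding lex_less_def by blast
  have prefix: "\<forall>j\<in>{1..<min i k}. \<beta> (Y j) = \<delta> (Y j)"
    using i(2) k(2) by auto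
  consider "i < k" | "k < i" | "i = k" by linarith
  then have "\<beta> (Y (min i k)) \<noteq> \<delta> (Y (min i k)) \<and>
    (\<beta> (Y (min i k)), \<delta> (Y (min i k))) \<in> ord T (ty (Y (min i k)))"
  proof cases
    case 1
    then have "\<gamma> (Y i) = \<delta> (Y i)" using i(1) k(2) by simp
    then show ?thesis using 1 i by simp
  next
    case 2
    then have "\<beta> (Y k) = \<gamma> (Y k)" using k(1) i(2) by simp
    then show ?thesis using 2 k by simp
  next
    case 3
    \<comment> \<open>At a common deciding index, equality of the outer values would by antisymmetry
      force the middle value to equal them.\<close>
    then show ?thesis using i k transD[OF ord(1)] antisymD[OF ord(2)] by (metis min.idem)
  qed
  moreover have "min i k \<in> {1..m}" using i(1) k(1) by (auto simp: min_def)
  ultimately show ?thesis using prefix unfolding lex_less_def by blast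
qed

lemma lex_less_comp_if_not_SBP:
  assumes T: "smt_theory T"
    and \<theta>: "symmetry ty (Y ` {1..m}) \<Omega> \<theta>"
    and \<beta>: "\<forall>v\<in>Y ` {1..m}. \<beta> v \<in> dom T (ty v)"
    and not_SBP: "\<not> holds T \<beta> (SBP ty Y m \<theta>)"
  shows "lex_less T ty Y m (\<beta> \<circ> \<theta>) \<beta>"
proof -
  obtain i where i: "i \<in> {1..m}" "\<forall>j\<in>{1..<i}. \<beta> (Y j) = \<beta> (\<theta> (Y j))"
      "(\<beta> (Y i), \<beta> (\<theta> (Y i))) \<notin> ord T (ty (Y i))"
    using not_SBP unfolding holds_SBP by blast
  have Yi: "Y i \<in> Y ` {1..m}" using i(1) by blast
  \<comment> \<open>Totality compares only elements of one domain; as \<open>\<theta>\<close>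
    preserves types, both values lie in the domain of \<open>ty (Y i)\<close>.\<close>
  then have "\<theta> (Y i) \<in> Y ` {1..m}" "ty (\<theta> (Y i)) = ty (Y i)"
    using \<theta> permutes_in_image unfolding symmetry_def by metis+
  then have dom: "\<beta> (Y i) \<in> dom T (ty (Y i))" "\<beta> (\<theta> (Y i)) \<in> dom T (ty (Y i))"
    using \<beta> Yi by metis+
  have "refl_on (dom T (ty (Y i))) (ord T (ty (Y i)))"
    and "total_on (dom T (ty (Y i))) (ord T (ty (Y i)))"
    using T by (auto simp: smt_theory_def order_on_defs)
  \<comment> \<open>Equal values would satisfy the failed comparison by reflexivity; for distinct
    ones totality reverses it.\<close>
  then have "\<beta> (\<theta> (Y i)) \<noteq> \<beta> (Y i)" and "(\<beta> (\<theta> (Y i)), \<beta> (Y i)) \<in> ord T (ty (Y i))"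
    using dom i(3) by (metis refl_onD, metis refl_onD total_on_def)
  then show ?thesis
    using i(1,2) unfolding lex_less_def by fastforce
qed

theorem theorem1:
  fixes T :: "('ty::linorder, 'f, 'c, 'd) smt_theory"
    and ty :: "'v \<Rightarrow> 'ty"
    and Y :: "nat \<Rightarrow> 'v"
    and m :: nat
    and \<Omega> :: "('ty, 'f, 'c, 'v) smt_formula"
    and \<theta> :: "'v \<Rightarrow> 'v"
  assumes "smt_theory T"
    and "inj_on Y {1..m}"
    and "mono_on {1..m} (\<lambda>i. ty (Y i))"
    and "well_typed T ty \<Omega>"
    and "vars \<Omega> \<subseteq> Y ` {1..m}"
    and "symmetry ty (Y ` {1..m}) \<Omega> \<theta>"
  shows "satisfiable T ty (Y ` {1..m}) \<Omega> \<longleftrightarrow>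
         satisfiable T ty (Y ` {1..m}) (Conj {|\<Omega>, SBP ty Y m \<theta>|})"
proof
  let ?V = "Y ` {1..m}"
  let ?model = "\<lambda>\<beta>. (\<forall>v\<in>?V. \<beta> v \<in> dom T (ty v)) \<and> holds T \<beta> \<Omega>"
  assume "satisfiable T ty ?V \<Omega>"
  then obtain \<alpha> where \<alpha>: "?model \<alpha>"
    unfolding satisfiable_def by blast
  \<comment> \<open>Over infinite domains such as the integers the lexicographic order need not be
    well-founded. Minimization is therefore confined to rearrangements of \<open>\<alpha>\<close>,
    finitely many because \<open>?V\<close> has finitely many permutations.\<close>
  define S where "S = {\<alpha> \<circ> p | p. p permutes ?V \<and> ?model (\<alpha> \<circ> p)}"
  have fin: "finite S"
    by (rule finite_subset[where B = "(\<lambda>p. \<alpha> \<circ> p) ` {p. p permutes ?V}"])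
      (auto simp: S_def finite_permutations)
  have "\<alpha> \<in> S"
    unfolding S_def mem_Collect_eq using \<alpha> permutes_id[of ?V] by (metis comp_id)
  have lin: "\<And>\<tau>. trans (ord T \<tau>)" "\<And>\<tau>. antisym (ord T \<tau>)"
    using assms(1) by (auto simp: smt_theory_def order_on_defs)
  have "transp_on S (lex_less T ty Y m)"
    by (rule transp_onI) (rule lex_less_trans[OF lin])
  moreover have "asymp_on S (lex_less T ty Y m)"
    by (rule asymp_onI) (use lex_less_trans[OF lin] lex_less_irrefl in metis)
  ultimately obtain \<beta> where \<beta>: "\<beta> \<in> S" "\<forall>\<gamma>\<in>S. \<gamma> \<noteq> \<beta> \<longrightarrow> \<not> lex_less T ty Y m \<gamma> \<beta>"
    using Finite_Set.bex_min_element[OF fin] \<open>\<alpha> \<in> S\<close> by blast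
  then obtain p where p: "p permutes ?V" "\<beta> = \<alpha> \<circ> p" and model: "?model \<beta>"
    unfolding S_def by blast
  have \<theta>: "\<theta> permutes ?V" "\<forall>v\<in>?V. ty (\<theta> v) = ty v" "rename \<theta> \<Omega> = \<Omega>"
    using assms(6) unfolding symmetry_def by auto
  have "holds T (\<beta> \<circ> \<theta>) \<Omega>"
    using model holds_rename[of T \<beta> \<theta> \<Omega>] \<theta>(3) by simp
  moreover have "\<forall>v\<in>?V. (\<beta> \<circ> \<theta>) v \<in> dom T (ty v)"
    using model \<theta>(2) permutes_in_image[OF \<theta>(1)] by (metis comp_apply)
  \<comment> \<open>Permutations compose, so \<open>\<beta> \<circ> \<theta>\<close> is again a
    rearrangement of \<open>\<alpha>\<close> and competes with \<open>\<beta>\<close> in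
    \<open>S\<close>.\<close>
  moreover have "\<beta> \<circ> \<theta> = \<alpha> \<circ> (p \<circ> \<theta>)" "(p \<circ> \<theta>) permutes ?V"
    using p(2) permutes_compose[OF \<theta>(1) p(1)] by (auto simp: comp_assoc)
  ultimately have "\<beta> \<circ> \<theta> \<in> S"
    unfolding S_def mem_Collect_eq by metis
  \<comment> \<open>Minimality speaks only of elements other than \<open>\<beta>\<close>;
    irreflexivity covers the case \<open>\<beta> \<circ> \<theta> = \<beta>\<close>.\<close>
  then have "\<not> lex_less T ty Y m (\<beta> \<circ> \<theta>) \<beta>"
    using \<beta>(2) lex_less_irrefl by metis
  then have "holds T \<beta> (SBP ty Y m \<theta>)"
    using lex_less_comp_if_not_SBP[OF assms(1,6)] model by blast
  then show "satisfiable T ty ?V (Conj {|\<Omega>, SBP ty Y m \<theta>|})"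
    using model unfolding satisfiable_def by auto
next
  assume "satisfiable T ty (Y ` {1..m}) (Conj {|\<Omega>, SBP ty Y m \<theta>|})"
  then show "satisfiable T ty (Y ` {1..m}) \<Omega>"
    unfolding satisfiable_def by auto
qed

end
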